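(* Let $\underline R$ be a commutative square ring, and $M,N$ two $\underline R$-BHP-modules. A map $f:M\to N$ is $\underline R$-BHP-quadratic if and only if it satisfies the following relations for all $m,m',m'',n\in M$, $r,s\in R_e$ and $x,y\in R_{ee}$: (a) $[f(m+m'),f(n)]\cdot x=[f(m),f(n)]\cdot x+[f(m'),f(n)]\cdot x$; (b) $[f(m\cdot r),f(n)]\cdot x=([f(m),f(n)]\cdot x)\cdot r$; (c) $[f([m,m']\cdot x),f(n)]\cdot y=0$; (d) $f(m+m'+m'')+f(m)+f(m')+f(m'')=f(m+m')+f(m'+m'')+f(m+m'')-[f(m'),f(m+m'')]$; (e) $f(m\cdot r+n\cdot s)=f(m+n)\cdot rs-f(n)\cdot rs-f(m)\cdot rs+f(m\cdot r)+f(n\cdot s)-[f(m),f(n)]\cdot H(rs)$; (f) $f([m,m']\cdot x+n)=f([m,m']\cdot x)+f(n)$; (g) $f(m\cdot sr)-f(m\cdot s)\cdot r=\bigl(f(m\cdot r)-f(m)\cdot r\bigr)\cdot s^2$; (h) $f(([m,n]\cdot x)\cdot r)=f([m,n]\cdot x)\cdot r$.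
   Context: A square ring $\underline R=(R_e\xrightarrow{H}R_{ee}\xrightarrow{P}R_e)$ consists of: a set $R_e$ with a group structure $+$ (not necessarily commutative) and an associative unital multiplication satisfying $r(s+t)=rs+rt$ (the law $(r+s)t=rt+st$ is not required); an abelian group $R_{ee}$; a map $R_e\times R_e\times R_{ee}\times R_e\to R_{ee}$, $(r,s,x,t)\mapsto(r,s)\cdot x\cdot t$, additive in each of its four variables and defining commuting actions on $R_{ee}$ of the multiplicative monoids $R_e\times R_e$ (on the left) and $R_e$ (on the right) (write $(r,s)\cdot x$ if $t=1$ and $x\cdot t$ if $r=s=1$); a group homomorphism $T:R_{ee}\to R_{ee}$ with $T^2=\mathrm{Id}$; a map $H:R_e\to R_{ee}$ and a group homomorphism $P:R_{ee}\to R_e$; such that for all $r,s,t\in R_e$, $x,y\in R_{ee}$: $PHP=P+P$; $P((r,r)\cdot x\cdot s)=rP(x)s$; $T=HP-\mathrm{Id}$; $PT=P$; $(P(x),r)\cdot y=(r,P(x))\cdot y=0=y\cdot P(x)$; $H(r+s)=H(r)+H(s)+(s,r)\cdot H(2)$ where $2=1+1$; $H(rs)=(r,r)\cdot H(s)+H(r)\cdot s$; $(r+s)t=rt+st+P((r,s)\cdot H(t))$; $T((r,s)\cdot x\cdot t)=(s,r)\cdot T(x)\cdot t$. The quotient $\overline R=R_e/\operatorname{Im}P$ is a ring. $\underline R$ is commutative if $\overline R$ is commutative and $(r,1)\cdot x=(1,r)\cdot x=x\cdot r$ for all $r\in R_e$, $x\in R_{ee}$. A (right) $\underline R$-BHP-module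 is a group $M$ (written additively, not necessarily commutative) with operations $M\times R_e\to M$, $(m,r)\mapsto m\cdot r$ and $M\times M\times R_{ee}\to M$, $(m,n,x)\mapsto[m,n]\cdot x$ such that: $m\cdot1=m$, $(m\cdot r)\cdot s=m\cdot(rs)$, $m\cdot(r+s)=m\cdot r+m\cdot s$; $(m+n)\cdot r=m\cdot r+n\cdot r+[m,n]\cdot H(r)$; $m\cdot P(x)=[m,m]\cdot x$; $[m,n]\cdot T(x)=[n,m]\cdot x$; $[m,n]\cdot x$ is additive in each of $m,n,x$; $([m\cdot r,n\cdot s]\cdot x)\cdot t=[m,n]\cdot((r,s)\cdot x\cdot t)$; $[[m,m']\cdot x,n]\cdot y=0$. A bracket $[m,n]$ not followed by an element of $R_{ee}$ denotes the commutator $m+n-m-n$. A map between BHP-modules is $\underline R$-linear if it is additive and commutes with the operations $\cdot r$ ($r\in R_e$) and $[-,-]\cdot x$ ($x\in R_{ee}$); a map $M\times M\to N$ is $\underline R$-bilinear if it is $\underline R$-linear in each variable separately. For a map $f:M\to N$ of BHP-modules put $d_f(m,m')=f(m+m')-f(m')-f(m)$; $f_{(r)}(m)=f(m\cdot r)-f(m)\cdot r$ for $r\in R_e$; $f_{[x]}(m,m')=f([m,m']\cdot x)-[f(m),f(m')]\cdot x$ for $x\in R_{ee}$. For a map $g$ from a set to a BHP-module $N$, $\operatorname{Im}_{\underline R}g$ is the smallest subgroup of $N$ containing the image of $g$ and stable under the operations of $R_e$ and $R_{ee}$. An element $u$ of a BHP-module $L$ is $\underline R$-central in $L$ if $[u,v]\cdot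 x=0$ for all $v\in L$, $x\in R_{ee}$. For $\underline R$ commutative, a map $f:M\to N$ is $\underline R$-BHP-quadratic if: (1) $\operatorname{Im}_{\underline R}d_f$, $\operatorname{Im}_{\underline R}f_{(r)}$ and $\operatorname{Im}_{\underline R}f_{[x]}$ consist of elements $\underline R$-central in $\operatorname{Im}_{\underline R}f$, for all $r\in R_e$, $x\in R_{ee}$; (2) $d_f$ and all $f_{[x]}$ are $\underline R$-bilinear; (3) $f_{(r)}(m\cdot s)=f_{(r)}(m)\cdot s^2$ for all $m\in M$, $r,s\in R_e$. *)

theory Defs
  imports Complex_Main "HOL.Hull"
begin

text \<open>
  The groups \<open>R\<^sub>e\<close>, \<open>R\<^sub>e\<^sub>e\<close> and the modules are types. The class \<^class>\<open>group_add\<close> is the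
  class of additively written groups that need not be commutative, and \<open>a - b\<close> is \<open>a + (- b)\<close>.
  The term \<open>act r s x t\<close> stands for \<open>(r,s) \<cdot> x \<cdot> t\<close>; so \<open>(r,s) \<cdot> x\<close> is \<open>act r s x 1\<close> and
  \<open>x \<cdot> t\<close> is \<open>act 1 1 x t\<close>. The element \<open>2\<close> of \<open>R\<^sub>e\<close> is written \<open>1 + 1\<close>.
\<close>

locale square_ring =
  fixes act :: "'r::{group_add,monoid_mult} \<Rightarrow> 'r \<Rightarrow> 'x::ab_group_add \<Rightarrow> 'r \<Rightarrow> 'x"
    and T :: "'x \<Rightarrow> 'x"
    and H :: "'r \<Rightarrow> 'x"
    and P :: "'x \<Rightarrow> 'r"
  assumes distrib_left: "r * (s + t) = r * s + r * t"
    and act_add1: "act (r + r') s x t = act r s x t + act r' s x t"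
    and act_add2: "act r (s + s') x t = act r s x t + act r s' x t"
    and act_add3: "act r s (x + y) t = act r s x t + act r s y t"
    and act_add4: "act r s x (t + t') = act r s x t + act r s x t'"
    and act_one: "act 1 1 x 1 = x"
    and act_left_mult: "act (r * r') (s * s') x 1 = act r s (act r' s' x 1) 1"
    and act_right_mult: "act 1 1 x (t * t') = act 1 1 (act 1 1 x t) t'"
    and act_left_right: "act r s (act 1 1 x t) 1 = act r s x t"
    and act_right_left: "act 1 1 (act r s x 1) t = act r s x t"
    and T_add: "T (x + y) = T x + T y"
    and T_T: "T (T x) = x"
    and P_add: "P (x + y) = P x + P y"
    and P_H_P: "P (H (P x)) = P x + P x"
    and P_act: "P (act r r x s) = r * P x * s"
    and T_eq: "T x = H (P x) - x"
    and P_T: "P (T x) = P x"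
    and act_P1: "act (P x) r y 1 = 0"
    and act_P2: "act r (P x) y 1 = 0"
    and act_P3: "act 1 1 y (P x) = 0"
    and H_add: "H (r + s) = H r + H s + act s r (H (1 + 1)) 1"
    and H_mult: "H (r * s) = act r r (H s) 1 + act 1 1 (H r) s"
    and distrib_right: "(r + s) * t = r * t + s * t + P (act r s (H t) 1)"
    and T_act: "T (act r s x t) = act s r (T x) t"
begin

text \<open>The quotient \<open>R\<^sub>e / Im P\<close>: its elements are the cosets, multiplied through representatives.\<close>

definition residue :: "'r \<Rightarrow> 'r set" where
  "residue r = {r + P x | x. True}"

definition quotient_carrier :: "'r set set" where
  "quotient_carrier = range residue"

definition quotient_mult :: "'r set \<Rightarrow> 'r set \<Rightarrow> 'r set" where
  "quotient_mult A B = (\<Union>a\<in>A. \<Union>b\<in>B. residue (a * b))"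

lemma P_zero: "P 0 = 0"
  by (metis P_add add.right_neutral add_left_cancel)

lemma residue_P: "residue (r + P x) = residue r"
proof -
  have "r + P x + P y = r + P (x + y)" for y
    by (simp add: P_add add.assoc)
  moreover have "r + P y = r + P x + P (- x + y)" for y
    by (simp add: add.assoc P_add[symmetric])
  ultimately show ?thesis
    unfolding residue_def by blast
qed

lemma mult_P:
  "\<exists>z. (r + P x) * (s + P y) = r * s + P z"
proof -
  have l: "(r + P x) * t = r * t + P (act 1 1 x t)" for t
    using P_act[of 1 x t] by (simp add: distrib_right act_P2 P_zero)
  have "r * P y = P (act r r y 1)"
    using P_act[of r y 1] by simp
  then show ?thesis
    using l[of "s + P y"] by (metis distrib_left add.assoc P_add)
qed

lemma quotient_mult_residue: "quotient_mult (residue r) (residue s) = residue (r * s)"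
proof -
  have "residue (a * b) = residue (r * s)" if a: "a \<in> residue r" and b: "b \<in> residue s" for a b
  proof -
    obtain x where "a = r + P x"
      using a unfolding residue_def by blast
    moreover obtain y where "b = s + P y"
      using b unfolding residue_def by blast
    ultimately show ?thesis
      using mult_P[of r x s y] residue_P by metis
  qed
  moreover have "r \<in> residue r" "s \<in> residue s"
    unfolding residue_def using P_zero by (metis (mono_tags, lifting) add.right_neutral mem_Collect_eq)+
  ultimately show ?thesis
    unfolding quotient_mult_def by blast
qed

end

locale commutative_square_ring = square_ring +
  assumes quotient_commute:
      "\<lbrakk>A \<in> quotient_carrier; B \<in> quotient_carrier\<rbrakk> \<Longrightarrow> quotient_mult A B = quotient_mult B A"
    and act_left1: "act r 1 x 1 = act 1 1 x r"
    and act_left2: "act 1 r x 1 = act 1 1 x r"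

text \<open>
  In a BHP-module, \<open>smul m r\<close> stands for \<open>m \<cdot> r\<close> and \<open>brk m n x\<close> for \<open>[m,n] \<cdot> x\<close>, which is a
  ternary operation. The plain bracket \<open>[m,n]\<close> is \<open>commutator m n\<close> below.
\<close>

locale bhp_module = square_ring act T H P
  for act :: "'r::{group_add,monoid_mult} \<Rightarrow> 'r \<Rightarrow> 'x::ab_group_add \<Rightarrow> 'r \<Rightarrow> 'x"
    and T :: "'x \<Rightarrow> 'x"
    and H :: "'r \<Rightarrow> 'x"
    and P :: "'x \<Rightarrow> 'r" +
  fixes smul :: "'m::group_add \<Rightarrow> 'r \<Rightarrow> 'm"
    and brk :: "'m \<Rightarrow> 'm \<Rightarrow> 'x \<Rightarrow> 'm"
  assumes smul_one: "smul m 1 = m"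
    and smul_smul: "smul (smul m r) s = smul m (r * s)"
    and smul_add_right: "smul m (r + s) = smul m r + smul m s"
    and smul_add_left: "smul (m + n) r = smul m r + smul n r + brk m n (H r)"
    and smul_P: "smul m (P x) = brk m m x"
    and brk_T: "brk m n (T x) = brk n m x"
    and brk_add1: "brk (m + m') n x = brk m n x + brk m' n x"
    and brk_add2: "brk m (n + n') x = brk m n x + brk m n' x"
    and brk_add3: "brk m n (x + y) = brk m n x + brk m n y"
    and smul_brk: "smul (brk (smul m r) (smul n s) x) t = brk m n (act r s x t)"
    and brk_brk: "brk (brk m m' x) n y = 0"

definition commutator :: "'m::group_add \<Rightarrow> 'm \<Rightarrow> 'm" where
  "commutator m n = m + n - m - n"

definition bhp_linear ::
  "('m::group_add \<Rightarrow> 'r \<Rightarrow> 'm) \<Rightarrow> ('m \<Rightarrow> 'm \<Rightarrow> 'x \<Rightarrow> 'm) \<Rightarrow>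
   ('n::group_add \<Rightarrow> 'r \<Rightarrow> 'n) \<Rightarrow> ('n \<Rightarrow> 'n \<Rightarrow> 'x \<Rightarrow> 'n) \<Rightarrow> ('m \<Rightarrow> 'n) \<Rightarrow> bool" where
  "bhp_linear smulM brkM smulN brkN g \<longleftrightarrow>
     (\<forall>m m'. g (m + m') = g m + g m') \<and>
     (\<forall>m r. g (smulM m r) = smulN (g m) r) \<and>
     (\<forall>m m' x. g (brkM m m' x) = brkN (g m) (g m') x)"

definition bhp_bilinear ::
  "('m::group_add \<Rightarrow> 'r \<Rightarrow> 'm) \<Rightarrow> ('m \<Rightarrow> 'm \<Rightarrow> 'x \<Rightarrow> 'm) \<Rightarrow>
   ('n::group_add \<Rightarrow> 'r \<Rightarrow> 'n) \<Rightarrow> ('n \<Rightarrow> 'n \<Rightarrow> 'x \<Rightarrow> 'n) \<Rightarrow> ('m \<Rightarrow> 'm \<Rightarrow> 'n) \<Rightarrow> bool" where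
  "bhp_bilinear smulM brkM smulN brkN g \<longleftrightarrow>
     (\<forall>m'. bhp_linear smulM brkM smulN brkN (\<lambda>m. g m m')) \<and>
     (\<forall>m. bhp_linear smulM brkM smulN brkN (\<lambda>m'. g m m'))"

definition cross_effect :: "('m::group_add \<Rightarrow> 'n::group_add) \<Rightarrow> 'm \<Rightarrow> 'm \<Rightarrow> 'n" where
  "cross_effect f m m' = f (m + m') - f m' - f m"

definition smul_defect ::
  "('m \<Rightarrow> 'r \<Rightarrow> 'm) \<Rightarrow> ('n::group_add \<Rightarrow> 'r \<Rightarrow> 'n) \<Rightarrow> ('m \<Rightarrow> 'n) \<Rightarrow> 'r \<Rightarrow> 'm \<Rightarrow> 'n" where
  "smul_defect smulM smulN f r m = f (smulM m r) - smulN (f m) r"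

definition brk_defect ::
  "('m \<Rightarrow> 'm \<Rightarrow> 'x \<Rightarrow> 'm) \<Rightarrow> ('n::group_add \<Rightarrow> 'n \<Rightarrow> 'x \<Rightarrow> 'n) \<Rightarrow> ('m \<Rightarrow> 'n) \<Rightarrow>
   'x \<Rightarrow> 'm \<Rightarrow> 'm \<Rightarrow> 'n" where
  "brk_defect brkM brkN f x m m' = f (brkM m m' x) - brkN (f m) (f m') x"

definition bhp_stable_subgroup ::
  "('n::group_add \<Rightarrow> 'r \<Rightarrow> 'n) \<Rightarrow> ('n \<Rightarrow> 'n \<Rightarrow> 'x \<Rightarrow> 'n) \<Rightarrow> 'n set \<Rightarrow> bool" where
  "bhp_stable_subgroup smul brk S \<longleftrightarrow>
     0 \<in> S \<and> (\<forall>u\<in>S. \<forall>v\<in>S. u + v \<in> S) \<and> (\<forall>u\<in>S. - u \<in> S) \<and>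
     (\<forall>u\<in>S. \<forall>r. smul u r \<in> S) \<and> (\<forall>u\<in>S. \<forall>v\<in>S. \<forall>x. brk u v x \<in> S)"

definition bhp_image ::
  "('n::group_add \<Rightarrow> 'r \<Rightarrow> 'n) \<Rightarrow> ('n \<Rightarrow> 'n \<Rightarrow> 'x \<Rightarrow> 'n) \<Rightarrow> ('a \<Rightarrow> 'n) \<Rightarrow> 'n set" where
  "bhp_image smul brk g = bhp_stable_subgroup smul brk hull range g"

definition bhp_center_of :: "('n::group_add \<Rightarrow> 'n \<Rightarrow> 'x \<Rightarrow> 'n) \<Rightarrow> 'n set \<Rightarrow> 'n set" where
  "bhp_center_of brk L = {u \<in> L. \<forall>v\<in>L. \<forall>x. brk u v x = 0}"

text \<open>
  The structure maps \<open>H\<close>, \<open>P\<close>, \<open>T\<close> of the square ring do not occur in the definition of a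
  quadratic map; it is meant for modules over a common commutative square ring.
\<close>

definition bhp_quadratic ::
  "('m::group_add \<Rightarrow> 'r::monoid_mult \<Rightarrow> 'm) \<Rightarrow> ('m \<Rightarrow> 'm \<Rightarrow> 'x \<Rightarrow> 'm) \<Rightarrow>
   ('n::group_add \<Rightarrow> 'r \<Rightarrow> 'n) \<Rightarrow> ('n \<Rightarrow> 'n \<Rightarrow> 'x \<Rightarrow> 'n) \<Rightarrow> ('m \<Rightarrow> 'n) \<Rightarrow> bool" where
  "bhp_quadratic smulM brkM smulN brkN f \<longleftrightarrow>
     bhp_image smulN brkN (\<lambda>(m, m'). cross_effect f m m')
       \<subseteq> bhp_center_of brkN (bhp_image smulN brkN f) \<and>
     (\<forall>r. bhp_image smulN brkN (smul_defect smulM smulN f r)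
       \<subseteq> bhp_center_of brkN (bhp_image smulN brkN f)) \<and>
     (\<forall>x. bhp_image smulN brkN (\<lambda>(m, m'). brk_defect brkM brkN f x m m')
       \<subseteq> bhp_center_of brkN (bhp_image smulN brkN f)) \<and>
     bhp_bilinear smulM brkM smulN brkN (cross_effect f) \<and>
     (\<forall>x. bhp_bilinear smulM brkM smulN brkN (brk_defect brkM brkN f x)) \<and>
     (\<forall>r s m. smul_defect smulM smulN f r (smulM m s) = smulN (smul_defect smulM smulN f r m) (s\<^sup>2))"

end

theory Submission
  imports Defs
begin

text \<open>
  An element that is annihilated by all brackets with the values of \<open>f\<close> is annihilated by all
  brackets with the substructure that \<open>f\<close> generates, and such elements themselves form a
  substructure. So the centrality conditions need only be tested on generators, where they are
  (a), (b) and (c). Commutators are brackets with \<open>H 2\<close>, so central elements commute with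
  everything in sight; modulo this, (d), (e), (f) say that the cross effect is bilinear,
  (f) and (h) that the bracket defects are, and (g) is the condition on the scalar defects.
\<close>

section \<open>Modules over a square ring\<close>

lemma diff_right_cancel: "a - c = b - c \<longleftrightarrow> a = b" for a b c :: "'a::group_add"
  unfolding diff_conv_add_uminus by (rule add_right_cancel)

context bhp_module
begin

section \<open>Arithmetic of brackets and commutators\<close>

lemma brk_zero1 [simp]: "brk 0 n x = 0"
  by (metis brk_add1 add.right_neutral add_left_cancel)

lemma brk_zero2 [simp]: "brk m 0 x = 0"
  by (metis brk_add2 add.right_neutral add_left_cancel)

lemma brk_minus1: "brk (- m) n x = - brk m n x"
  by (metis brk_add1 brk_zero1 add.right_inverse minus_unique)

lemma brk_minus2: "brk m (- n) x = - brk m n x"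
  by (metis brk_add2 brk_zero2 add.right_inverse minus_unique)

lemma brk_diff1: "brk (m - m') n x = brk m n x - brk m' n x"
  using brk_add1[of m "- m'"] by (simp add: brk_minus1)

lemma brk_diff2: "brk m (n - n') x = brk m n x - brk m n' x"
  using brk_add2[of m n "- n'"] by (simp add: brk_minus2)

lemma brk_brk2 [simp]: "brk m (brk n n' x) y = 0"
  by (metis brk_T brk_brk)

declare brk_brk [simp]

lemma brk_smul1: "brk (smul m r) n x = brk m n (act r 1 x 1)"
  using smul_brk[of m r n 1 x 1] by (simp add: smul_one)

lemma brk_smul2: "brk m (smul n r) x = brk m n (act 1 r x 1)"
  using smul_brk[of m 1 n r x 1] by (simp add: smul_one)

lemma smul_brk': "smul (brk m n x) r = brk m n (act 1 1 x r)"
  using smul_brk[of m 1 n 1 x r] by (simp add: smul_one)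

text \<open>Expanding \<open>smul (m + n) (1 + 1)\<close> by \<open>smul_add_right\<close> and by
  \<open>smul_add_left\<close> gives two expressions that start with \<open>m\<close>. The final
  \<open>n\<close> stays until bracket values are known to commute with it.\<close>

lemma add_swap_aux: "n + m = m + n + n + brk m n (H (1 + 1)) - n"
proof -
  have "m + (n + m + n) = m + (m + n + n + brk m n (H (1 + 1)))"
    using smul_add_left[of m n "1 + 1"] by (simp add: smul_add_right smul_one add.assoc)
  then have "n + m + n = m + n + n + brk m n (H (1 + 1))"
    by (simp only: add_left_cancel)
  then show ?thesis
    by (simp flip: \<open>n + m + n = _\<close>)
qed

lemma commute_if_brk_zero:
  assumes "\<And>x. brk u v x = 0"
  shows "u + v = v + u"
  using add_swap_aux[of v u] assms by simp

lemma brk_commute: "brk m n x + k = k + brk m n x"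
  by (rule commute_if_brk_zero) simp

lemma add_swap: "n + m = m + n + brk m n (H (1 + 1))"
proof -
  have "n + m = m + n + (n + brk m n (H (1 + 1))) - n"
    unfolding add.assoc[symmetric] by (rule add_swap_aux)
  also have "\<dots> = m + n + brk m n (H (1 + 1)) + n - n"
    using brk_commute[of m n "H (1 + 1)" n] by (simp only: add.assoc)
  finally show ?thesis
    by simp
qed

lemma commutator_eq_brk: "commutator m n = brk n m (H (1 + 1))"
proof -
  have "m + n = brk n m (H (1 + 1)) + (n + m)"
    unfolding brk_commute by (rule add_swap)
  then show ?thesis
    unfolding commutator_def by (simp add: diff_diff_eq2 flip: add.assoc)
qed

lemma smul_add_left_central:
  assumes "\<And>x. brk u v x = 0"
  shows "smul (u + v) r = smul u r + smul v r"
  using assms by (simp add: smul_add_left)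

text \<open>Adding the bracket back produces a correction term that is a double bracket, hence
  zero.\<close>

lemma smul_diff_left_brk:
  "smul (u - brk m n x) r = smul u r - smul (brk m n x) r"
proof -
  have "smul (u - brk m n x) r + smul (brk m n x) r = smul u r"
    using smul_add_left[of "u - brk m n x" "brk m n x" r] by simp
  then show ?thesis
    by (metis add_diff_cancel)
qed

section \<open>Generated substructures and their centres\<close>

lemma bhp_image_stable: "bhp_stable_subgroup smul brk (bhp_image smul brk g)"
  unfolding bhp_image_def
  by (rule hull_in) (simp add: bhp_stable_subgroup_def)

lemma in_bhp_image: "g p \<in> bhp_image smul brk g"
  unfolding bhp_image_def by (rule hull_inc) simp

lemma bhp_image_subset_iff:
  assumes "bhp_stable_subgroup smul brk S"
  shows "bhp_image smul brk g \<subseteq> S \<longleftrightarrow> (\<forall>p. g p \<in> S)"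
proof
  assume "bhp_image smul brk g \<subseteq> S"
  then show "\<forall>p. g p \<in> S"
    by (auto intro: subsetD in_bhp_image)
next
  assume "\<forall>p. g p \<in> S"
  then show "bhp_image smul brk g \<subseteq> S"
    unfolding bhp_image_def by (intro hull_minimal assms) auto
qed

lemma bhp_center_stable:
  assumes "bhp_stable_subgroup smul brk L"
  shows "bhp_stable_subgroup smul brk (bhp_center_of brk L)"
  using assms unfolding bhp_stable_subgroup_def bhp_center_of_def
  by (auto simp: brk_add1 brk_minus1 brk_smul1)

text \<open>Stability under \<open>brk\<close> is the vanishing of double brackets. A scalar on
  \<open>v\<close> only changes \<open>x\<close>, which is why all \<open>x\<close> are quantified
  together.\<close>

lemma annihilator_stable: "bhp_stable_subgroup smul brk {v. \<forall>x. brk u v x = 0}"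
  unfolding bhp_stable_subgroup_def
  by (auto simp: brk_add2 brk_minus2 brk_smul2)

lemma in_bhp_center_image_iff:
  "u \<in> bhp_center_of brk (bhp_image smul brk g) \<longleftrightarrow>
    u \<in> bhp_image smul brk g \<and> (\<forall>p x. brk u (g p) x = 0)"
proof -
  have "(\<forall>p x. brk u (g p) x = 0) \<longleftrightarrow> bhp_image smul brk g \<subseteq> {v. \<forall>x. brk u v x = 0}"
    using bhp_image_subset_iff[OF annihilator_stable] by blast
  then show ?thesis
    unfolding bhp_center_of_def by blast
qed

text \<open>The centre is itself a substructure, which reduces the left argument to generators;
  annihilators are substructures, which reduces the right one.\<close>

lemma bhp_image_central_iff:
  assumes "\<And>q. h q \<in> bhp_image smul brk g"
  shows "bhp_image smul brk h \<subseteq> bhp_center_of brk (bhp_image smul brk g) \<longleftrightarrow>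
    (\<forall>q p x. brk (h q) (g p) x = 0)"
  unfolding bhp_image_subset_iff[OF bhp_center_stable[OF bhp_image_stable]]
  by (simp add: in_bhp_center_image_iff assms)

lemma bhp_image_closed:
  shows bhp_image_diff:
      "u \<in> bhp_image smul brk g \<Longrightarrow> v \<in> bhp_image smul brk g \<Longrightarrow> u - v \<in> bhp_image smul brk g"
    and bhp_image_smul: "u \<in> bhp_image smul brk g \<Longrightarrow> smul u r \<in> bhp_image smul brk g"
    and bhp_image_brk:
      "u \<in> bhp_image smul brk g \<Longrightarrow> v \<in> bhp_image smul brk g \<Longrightarrow> brk u v x \<in> bhp_image smul brk g"
  using bhp_image_stable[of g] unfolding bhp_stable_subgroup_def diff_conv_add_uminus
  by (simp_all del: add_uminus_conv_diff)

text \<open>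
  Here \<open>d\<^sub>1\<^sub>2\<close>, \<open>d\<^sub>1\<^sub>3\<close>, \<open>d\<^sub>2\<^sub>3\<close> are cross effects of the arguments whose values are \<open>a\<close>, \<open>b\<close>, \<open>c\<close>.
\<close>

lemma second_order_iff:
  assumes d13: "\<And>x. brk d13 a x = 0" "\<And>x. brk d13 b x = 0" "\<And>x. brk d13 c x = 0"
    and d23: "\<And>x. brk d23 a x = 0" "\<And>x. brk d23 b x = 0"
    and dd: "\<And>x. brk d23 d12 x = 0" "\<And>x. brk d13 d12 x = 0" "\<And>x. brk d13 d23 x = 0"
  shows "t + a + b + c = (d12 + a + b) + (d23 + b + c) + (d13 + a + c) - commutator b (d13 + a + c)
    \<longleftrightarrow> t = d13 + d23 + d12 + a + b + c"
proof -
  \<comment> \<open>Moving \<open>b\<close> past \<open>c + a\<close> in the sum of the three values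
    produces this bracket. Bracket values commute with each other, so it is also the bracket of
    \<open>a + c\<close> with \<open>b\<close>.\<close>
  define z where "z = brk (c + a) b (H (1 + 1))"
  have "brk (d13 + a + c) b (H (1 + 1)) = z"
    unfolding z_def brk_add1 d13 add_0_left by (rule brk_commute)
  then have comm: "commutator b (d13 + a + c) = z"
    by (simp add: commutator_eq_brk)
  have z: "b + (c + a) = c + a + b + z"
    unfolding z_def by (rule add_swap)
  have z': "z + c = c + z"
    unfolding z_def by (rule brk_commute)
  have c23: "d23 + (d12 + a + b) = (d12 + a + b) + d23"
    by (rule commute_if_brk_zero) (simp add: brk_add2 d23 dd)
  have c13: "d13 + (d23 + (d12 + a + b + b + c)) = (d23 + (d12 + a + b + b + c)) + d13"
    by (rule commute_if_brk_zero) (simp add: brk_add2 d13 dd)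
  have "(d12 + a + b) + (d23 + b + c) + (d13 + a + c) = ((d12 + a + b) + d23) + (b + c + (d13 + a + c))"
    by (simp only: add.assoc)
  also have "\<dots> = (d23 + (d12 + a + b + b + c)) + d13 + (a + c)"
    unfolding c23[symmetric] by (simp only: add.assoc)
  also have "\<dots> = d13 + d23 + d12 + a + b + (b + (c + a)) + c"
    unfolding c13[symmetric] by (simp only: add.assoc)
  also have "\<dots> = (d13 + d23 + d12 + a + b + c) + a + b + c + z"
    unfolding z by (simp only: add.assoc z')
  finally have "(d12 + a + b) + (d23 + b + c) + (d13 + a + c) - z
      = (d13 + d23 + d12 + a + b + c) + a + b + c"
    by (simp only: add_diff_cancel)
  then show ?thesis
    unfolding comm by simp
qed

end


text \<open>Commutativity of the quotient ring, expressed by representatives.\<close>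

lemma (in commutative_square_ring) mult_commute_mod_P: "\<exists>z. r * s = s * r + P z"
proof -
  have "residue (r * s) = residue (s * r)"
    using quotient_commute[of "residue r" "residue s"]
    by (simp add: quotient_carrier_def quotient_mult_residue)
  moreover have "r * s \<in> residue (r * s)"
    unfolding residue_def using P_zero by (metis (mono_tags, lifting) add.right_neutral mem_Collect_eq)
  ultimately show ?thesis
    unfolding residue_def by auto
qed

section \<open>Maps between modules\<close>

locale bhp_map = commutative_square_ring act T H P +
    M: bhp_module act T H P smulM brkM + N: bhp_module act T H P smulN brkN
  for act :: "'r::{group_add,monoid_mult} \<Rightarrow> 'r \<Rightarrow> 'x::ab_group_add \<Rightarrow> 'r \<Rightarrow> 'x"
    and T H P
    and smulM :: "'m::group_add \<Rightarrow> 'r \<Rightarrow> 'm" (infixl \<open>\<cdot>\<^sub>M\<close> 75) and brkM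
    and smulN :: "'n::group_add \<Rightarrow> 'r \<Rightarrow> 'n" (infixl \<open>\<cdot>\<^sub>N\<close> 75) and brkN +
  fixes f :: "'m \<Rightarrow> 'n"
begin

section \<open>Defects of \<open>f\<close> and their centrality\<close>

abbreviation d where "d \<equiv> cross_effect f"
abbreviation sd where "sd \<equiv> smul_defect smulM smulN f"
abbreviation bd where "bd \<equiv> brk_defect brkM brkN f"

lemma smul_brk_left:
  "brkM (m \<cdot>\<^sub>M r) m' x = brkM m m' x \<cdot>\<^sub>M r" "brkN (n \<cdot>\<^sub>N r) n' x = brkN n n' x \<cdot>\<^sub>N r"
  by (simp_all add: M.brk_smul1 M.smul_brk' N.brk_smul1 N.smul_brk' act_left1)

lemma smul_brk_right:
  "brkM m (m' \<cdot>\<^sub>M r) x = brkM m m' x \<cdot>\<^sub>M r" "brkN n (n' \<cdot>\<^sub>N r) x = brkN n n' x \<cdot>\<^sub>N r"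
  by (simp_all add: M.brk_smul2 M.smul_brk' N.brk_smul2 N.smul_brk' act_left2)

lemma f_add: "f (m + m') = d m m' + f m + f m'"
  by (simp add: cross_effect_def)

lemma cross_effect_zero_iff: "d m m' = 0 \<longleftrightarrow> f (m + m') = f m + f m'"
  unfolding f_add add.assoc using add_right_cancel[of "d m m'" "f m + f m'" 0] by simp

lemma cross_effect_central_iff:
  "brkN (d m m') (f n) x = 0 \<longleftrightarrow>
    brkN (f (m + m')) (f n) x = brkN (f m) (f n) x + brkN (f m') (f n) x"
  unfolding f_add N.brk_add1 add.assoc
  using add_right_cancel[of "brkN (d m m') (f n) x" "brkN (f m) (f n) x + brkN (f m') (f n) x" 0]
  by simp

lemma smul_defect_central_iff:
  "brkN (sd r m) (f n) x = 0 \<longleftrightarrow> brkN (f (m \<cdot>\<^sub>M r)) (f n) x = brkN (f m) (f n) x \<cdot>\<^sub>N r"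
  by (simp add: smul_defect_def N.brk_diff1 smul_brk_left)

text \<open>The other summand of the defect is a bracket value, so its bracket with
  \<open>f n\<close> vanishes.\<close>

lemma brk_defect_central_iff:
  "brkN (bd x m m') (f n) y = 0 \<longleftrightarrow> brkN (f (brkM m m' x)) (f n) y = 0"
  by (simp add: brk_defect_def N.brk_diff1)

lemma bhp_quadratic_iff:
  "bhp_quadratic smulM brkM smulN brkN f \<longleftrightarrow>
     (\<forall>m m' n x. brkN (f (m + m')) (f n) x = brkN (f m) (f n) x + brkN (f m') (f n) x) \<and>
     (\<forall>m r n x. brkN (f (m \<cdot>\<^sub>M r)) (f n) x = brkN (f m) (f n) x \<cdot>\<^sub>N r) \<and>
     (\<forall>m m' x n y. brkN (f (brkM m m' x)) (f n) y = 0) \<and>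
     bhp_bilinear smulM brkM smulN brkN d \<and>
     (\<forall>x. bhp_bilinear smulM brkM smulN brkN (bd x)) \<and>
     (\<forall>r s m. sd r (m \<cdot>\<^sub>M s) = sd r m \<cdot>\<^sub>N s\<^sup>2)"
proof -
  \<comment> \<open>All defects lie in the substructure generated by \<open>f\<close>, so only the
    annihilation condition of the centre remains to be tested.\<close>
  have d: "(case q of (m, m') \<Rightarrow> d m m') \<in> bhp_image smulN brkN f" for q
    by (cases q) (simp add: cross_effect_def N.bhp_image_closed N.in_bhp_image)
  have sd: "sd r m \<in> bhp_image smulN brkN f" for r m
    by (simp add: smul_defect_def N.bhp_image_closed N.in_bhp_image)
  have bd: "(case q of (m, m') \<Rightarrow> bd x m m') \<in> bhp_image smulN brkN f" for q x
    by (cases q) (simp add: brk_defect_def N.bhp_image_closed N.in_bhp_image)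
  show ?thesis
    unfolding bhp_quadratic_def N.bhp_image_central_iff[OF d] N.bhp_image_central_iff[OF sd]
      N.bhp_image_central_iff[OF bd] split_paired_All prod.case
      cross_effect_central_iff smul_defect_central_iff brk_defect_central_iff
    by (intro conj_cong refl) blast+
qed

end

section \<open>Maps satisfying (a), (b) and (c)\<close>

locale bhp_map_central = bhp_map +
  assumes brk_f_add: "brkN (f (m + m')) (f n) x = brkN (f m) (f n) x + brkN (f m') (f n) x"
    and brk_f_smul: "brkN (f (m \<cdot>\<^sub>M r)) (f n) x = brkN (f m) (f n) x \<cdot>\<^sub>N r"
    and brk_f_brk: "brkN (f (brkM m m' x)) (f n) y = 0"
begin

lemma brk_f_smul2: "brkN (f n) (f (m \<cdot>\<^sub>M r)) x = brkN (f n) (f m) x \<cdot>\<^sub>N r"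
  using brk_f_smul[of m r n "T x"] by (simp add: N.brk_T)

lemma brk_f_brk2: "brkN (f n) (f (brkM m m' x)) y = 0"
  using brk_f_brk[of m m' x n "T y"] by (simp add: N.brk_T)

lemma brk_f_add2: "brkN (f n) (f (m + m')) x = brkN (f n) (f m) x + brkN (f n) (f m') x"
  using brk_f_add[of m m' n "T x"] by (simp add: N.brk_T)

lemma brk_cross_f [simp]: "brkN (d m m') (f n) x = 0"
  by (simp add: cross_effect_central_iff brk_f_add)

lemma brk_cross_cross [simp]: "brkN (d m m') (d k l) x = 0"
  unfolding cross_effect_def[of f k l] by (simp add: N.brk_diff2)

lemma brk_defect_brk [simp]: "brkN (bd x m m') (bd y k l) z = 0"
  unfolding brk_defect_def by (simp add: N.brk_diff1 N.brk_diff2 brk_f_brk)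

text \<open>The two products differ by some \<open>P z\<close>, which acts on \<open>u\<close> as
  \<open>brkN u u z\<close>; this is zero because cross effects annihilate each other.\<close>

lemma cross_smul_commute: "d m n \<cdot>\<^sub>N (r * s) = d m n \<cdot>\<^sub>N (s * r)"
  using mult_commute_mod_P[of r s] by (auto simp: N.smul_add_right N.smul_P)

lemma third_difference_iff:
  "f (m + m' + m'') + f m + f m' + f m'' =
      f (m + m') + f (m' + m'') + f (m + m'') - commutator (f m') (f (m + m'')) \<longleftrightarrow>
    f (m + m' + m'') = d m m'' + d m' m'' + d m m' + f m + f m' + f m''"
  unfolding f_add[of m m'] f_add[of m' m''] f_add[of m m'']
  by (rule N.second_order_iff) simp_all

text \<open>Read the triple sum as \<open>(m + m') + m''\<close>, expand \<open>f\<close> twice and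
  cancel what is common with the expansion in \<open>third_difference_iff\<close>.\<close>

lemma cross_add_left_iff:
  "f (m + m' + m'') + f m + f m' + f m'' =
      f (m + m') + f (m' + m'') + f (m + m'') - commutator (f m') (f (m + m'')) \<longleftrightarrow>
    d (m + m') m'' = d m m'' + d m' m''"
  unfolding third_difference_iff
  unfolding f_add[of "m + m'" m''] f_add[of m m']
  by (simp flip: add.assoc)

text \<open>Now the triple sum is read as \<open>m + (m' + m'')\<close>; cross effects commute with
  each other and with values of \<open>f\<close>. Thus (d) alone encodes additivity in both
  variables.\<close>

lemma cross_add_right_iff:
  "f (m + m' + m'') + f m + f m' + f m'' =
      f (m + m') + f (m' + m'') + f (m + m'') - commutator (f m') (f (m + m'')) \<longleftrightarrow>
    d m (m' + m'') = d m m' + d m m''"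
proof -
  have "f (m + m' + m'') = d m (m' + m'') + (f m + d m' m'') + f m' + f m''"
    unfolding add.assoc[of m] f_add[of m "m' + m''"] f_add[of m' m''] by (simp only: add.assoc)
  also have "f m + d m' m'' = d m' m'' + f m"
    by (rule N.commute_if_brk_zero[symmetric]) simp
  finally have f: "f (m + m' + m'') = d m (m' + m'') + d m' m'' + f m + f m' + f m''"
    by (simp only: add.assoc)
  have "d m m'' + (d m' m'' + d m m') = (d m' m'' + d m m') + d m m''"
    by (rule N.commute_if_brk_zero) (simp add: N.brk_add2)
  also have "\<dots> = (d m m' + d m m'') + d m' m''"
    using N.commute_if_brk_zero[of "d m' m''" "d m m' + d m m''"]
    by (simp add: N.brk_add2 add.assoc)
  finally show ?thesis
    unfolding third_difference_iff
    unfolding f by (simp flip: add.assoc)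
qed

text \<open>The bracket with \<open>H (r * s)\<close> cancels exactly the failure of
  \<open>r * s\<close> to act additively on \<open>f m + f n\<close>; the cross effect, being
  central, splits off without correction.\<close>

lemma cross_smul_iff:
  "f (m \<cdot>\<^sub>M r + n \<cdot>\<^sub>M s) =
      f (m + n) \<cdot>\<^sub>N (r * s) - f n \<cdot>\<^sub>N (r * s) - f m \<cdot>\<^sub>N (r * s)
        + f (m \<cdot>\<^sub>M r) + f (n \<cdot>\<^sub>M s) - brkN (f m) (f n) (H (r * s)) \<longleftrightarrow>
    d (m \<cdot>\<^sub>M r) (n \<cdot>\<^sub>M s) = d m n \<cdot>\<^sub>N (r * s)"
proof -
  define t z where "t = r * s" and "z = brkN (f m) (f n) (H t)"
  have z: "k + z = z + k" for k
    unfolding z_def by (rule N.brk_commute[symmetric])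
  have z': "k + (z + l) = z + (k + l)" for k l
    by (simp only: z flip: add.assoc)
  have "f (m + n) \<cdot>\<^sub>N t = d m n \<cdot>\<^sub>N t + (f m + f n) \<cdot>\<^sub>N t"
    unfolding f_add add.assoc by (rule N.smul_add_left_central) (simp add: N.brk_add2)
  also have "\<dots> = d m n \<cdot>\<^sub>N t + (f m \<cdot>\<^sub>N t + f n \<cdot>\<^sub>N t + z)"
    by (simp add: N.smul_add_left z_def)
  also have "\<dots> = d m n \<cdot>\<^sub>N t + z + f m \<cdot>\<^sub>N t + f n \<cdot>\<^sub>N t"
    by (simp only: add.assoc z z')
  finally have "f (m + n) \<cdot>\<^sub>N t - f n \<cdot>\<^sub>N t - f m \<cdot>\<^sub>N t = d m n \<cdot>\<^sub>N t + z"
    by (simp only: add_diff_cancel)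
  moreover have "d m n \<cdot>\<^sub>N t + z + f (m \<cdot>\<^sub>M r) + f (n \<cdot>\<^sub>M s)
      = d m n \<cdot>\<^sub>N t + f (m \<cdot>\<^sub>M r) + f (n \<cdot>\<^sub>M s) + z"
    by (simp only: add.assoc z z')
  ultimately show ?thesis
    unfolding t_def[symmetric] z_def[symmetric] f_add[of "m \<cdot>\<^sub>M r" "n \<cdot>\<^sub>M s"]
    by (simp only: add_diff_cancel add_right_cancel)
qed

text \<open>Both sides subtract the same element
  \<open>brkN (f m) (f n) x \<cdot>\<^sub>N r\<close>.\<close>

lemma brk_defect_smul_iff:
  "bd x (m \<cdot>\<^sub>M r) n = bd x m n \<cdot>\<^sub>N r \<longleftrightarrow> f (brkM m n x \<cdot>\<^sub>M r) = f (brkM m n x) \<cdot>\<^sub>N r"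
  "bd x m (n \<cdot>\<^sub>M r) = bd x m n \<cdot>\<^sub>N r \<longleftrightarrow> f (brkM m n x \<cdot>\<^sub>M r) = f (brkM m n x) \<cdot>\<^sub>N r"
  by (simp_all add: brk_defect_def smul_brk_left smul_brk_right brk_f_smul brk_f_smul2
      N.smul_diff_left_brk diff_right_cancel)

lemma cross_bilinear_iff:
  "bhp_bilinear smulM brkM smulN brkN d \<longleftrightarrow>
    (\<forall>m m' m''. f (m + m' + m'') + f m + f m' + f m'' =
      f (m + m') + f (m' + m'') + f (m + m'') - commutator (f m') (f (m + m''))) \<and>
    (\<forall>m n r s. f (m \<cdot>\<^sub>M r + n \<cdot>\<^sub>M s) =
      f (m + n) \<cdot>\<^sub>N (r * s) - f n \<cdot>\<^sub>N (r * s) - f m \<cdot>\<^sub>N (r * s)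
        + f (m \<cdot>\<^sub>M r) + f (n \<cdot>\<^sub>M s) - brkN (f m) (f n) (H (r * s))) \<and>
    (\<forall>m m' n x. f (brkM m m' x + n) = f (brkM m m' x) + f n)"
  (is "?L \<longleftrightarrow> ?add \<and> ?smul \<and> ?brk")
proof
  assume ?L
  then have lin: "d (m + m') n = d m n + d m' n" "d (m \<cdot>\<^sub>M r) n = d m n \<cdot>\<^sub>N r"
    "d m (n \<cdot>\<^sub>M r) = d m n \<cdot>\<^sub>N r" "d (brkM m m' x) n = brkN (d m n) (d m' n) x" for m m' n r x
    unfolding bhp_bilinear_def bhp_linear_def by blast+
  have ?add
    unfolding cross_add_left_iff by (simp add: lin)
  moreover have ?smul
    \<comment> \<open>Pulling out the scalars one at a time may yield \<open>s * r\<close> instead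
      of \<open>r * s\<close>.\<close>
    unfolding cross_smul_iff by (simp add: lin N.smul_smul cross_smul_commute)
  moreover have ?brk
    by (simp add: lin flip: cross_effect_zero_iff)
  ultimately show "?add \<and> ?smul \<and> ?brk"
    by blast
next
  assume R: "?add \<and> ?smul \<and> ?brk"
  have "d (m + m') n = d m n + d m' n" "d m (n + n') = d m n + d m n'" for m m' n n'
    using R cross_add_left_iff cross_add_right_iff by blast+
  moreover have smul: "d (m \<cdot>\<^sub>M r) (n \<cdot>\<^sub>M s) = d m n \<cdot>\<^sub>N (r * s)" for m n r s
    using R cross_smul_iff by blast
  \<comment> \<open>Setting one of the two scalars to \<open>1\<close> separates the
    variables.\<close>
  have "d (m \<cdot>\<^sub>M r) n = d m n \<cdot>\<^sub>N r" "d m (n \<cdot>\<^sub>M r) = d m n \<cdot>\<^sub>N r" for m n r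
    using smul[of m r n 1] smul[of m 1 n r] by (simp_all add: M.smul_one)
  moreover have brk: "f (brkM m m' x + n) = f (brkM m m' x) + f n" for m m' n x
    using R by blast
  then have "d (brkM m m' x) n = 0" for m m' n x
    by (simp add: cross_effect_zero_iff)
  \<comment> \<open>Relation (f) has the bracket on the left only; the other side follows because
    brackets commute in the source and, by (c), their images commute with values of
    \<open>f\<close>.\<close>
  moreover have "d n (brkM m m' x) = 0" for m m' n x
    unfolding cross_effect_zero_iff M.brk_commute[symmetric] brk
    by (rule N.commute_if_brk_zero) (rule brk_f_brk)
  ultimately show ?L
    unfolding bhp_bilinear_def bhp_linear_def by simp
qed

text \<open>Given (f), additivity is automatic and compatibility with brackets reads
  \<open>0 = 0\<close>, so only the scalar condition (h) is left.\<close>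

lemma brk_defect_bilinear_iff:
  assumes f_brk: "\<And>m m' n x. f (brkM m m' x + n) = f (brkM m m' x) + f n"
  shows "bhp_bilinear smulM brkM smulN brkN (bd x) \<longleftrightarrow>
    (\<forall>m n r. f (brkM m n x \<cdot>\<^sub>M r) = f (brkM m n x) \<cdot>\<^sub>N r)"
proof -
  have "f 0 + f 0 = f 0 + 0"
    using f_brk[of 0 0 x 0] by simp
  then have f_zero: "f 0 = 0"
    by (simp only: add_left_cancel)
  \<comment> \<open>Bracket values commute with everything, so a difference of sums splits termwise
    in spite of noncommutativity.\<close>
  have interchange: "u + v - (brkN k l x + brkN k' l' x) = (u - brkN k l x) + (v - brkN k' l' x)"
    for u v k l k' l'
  proof -
    have "u + v - (brkN k l x + brkN k' l' x) = u + v - (brkN k' l' x + brkN k l x)"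
      by (simp only: N.brk_commute[of k])
    also have "\<dots> = u + (v + brkN (- k) l x) - brkN k' l' x"
      by (simp only: diff_conv_add_uminus minus_add add.assoc N.brk_minus1)
    also have "\<dots> = (u - brkN k l x) + (v - brkN k' l' x)"
      by (simp only: N.brk_commute[of "- k", symmetric])
        (simp only: diff_conv_add_uminus add.assoc N.brk_minus1)
    finally show ?thesis .
  qed
  have "bd x (m + m') n = bd x m n + bd x m' n" "bd x m (n + n') = bd x m n + bd x m n'" for m m' n n'
    by (simp_all add: brk_defect_def M.brk_add1 M.brk_add2 f_brk brk_f_add brk_f_add2 interchange)
  moreover have "bd x (brkM m m' y) n = 0" "bd x n (brkM m m' y) = 0" for m m' n y
    by (simp_all add: brk_defect_def f_zero brk_f_brk brk_f_brk2)
  ultimately show ?thesis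
    unfolding bhp_bilinear_def bhp_linear_def by (simp add: brk_defect_smul_iff) blast
qed

end

theorem proposition3p2p14:
  fixes act :: "'r::{group_add,monoid_mult} \<Rightarrow> 'r \<Rightarrow> 'x::ab_group_add \<Rightarrow> 'r \<Rightarrow> 'x"
    and T :: "'x \<Rightarrow> 'x"
    and H :: "'r \<Rightarrow> 'x"
    and P :: "'x \<Rightarrow> 'r"
    and smulM :: "'m::group_add \<Rightarrow> 'r \<Rightarrow> 'm" (infixl \<open>\<cdot>\<^sub>M\<close> 75)
    and brkM :: "'m \<Rightarrow> 'm \<Rightarrow> 'x \<Rightarrow> 'm"
    and smulN :: "'n::group_add \<Rightarrow> 'r \<Rightarrow> 'n" (infixl \<open>\<cdot>\<^sub>N\<close> 75)
    and brkN :: "'n \<Rightarrow> 'n \<Rightarrow> 'x \<Rightarrow> 'n"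
    and f :: "'m \<Rightarrow> 'n"
  assumes "commutative_square_ring act T H P"
    and "bhp_module act T H P smulM brkM"
    and "bhp_module act T H P smulN brkN"
  shows "bhp_quadratic smulM brkM smulN brkN f \<longleftrightarrow>
    (\<forall>m m' m'' n r s x y.
      brkN (f (m + m')) (f n) x = brkN (f m) (f n) x + brkN (f m') (f n) x \<and>
      brkN (f (m \<cdot>\<^sub>M r)) (f n) x = brkN (f m) (f n) x \<cdot>\<^sub>N r \<and>
      brkN (f (brkM m m' x)) (f n) y = 0 \<and>
      f (m + m' + m'') + f m + f m' + f m'' =
        f (m + m') + f (m' + m'') + f (m + m'') - commutator (f m') (f (m + m'')) \<and>
      f (m \<cdot>\<^sub>M r + n \<cdot>\<^sub>M s) =
        f (m + n) \<cdot>\<^sub>N (r * s) - f n \<cdot>\<^sub>N (r * s) - f m \<cdot>\<^sub>N (r * s)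
          + f (m \<cdot>\<^sub>M r) + f (n \<cdot>\<^sub>M s) - brkN (f m) (f n) (H (r * s)) \<and>
      f (brkM m m' x + n) = f (brkM m m' x) + f n \<and>
      f (m \<cdot>\<^sub>M (s * r)) - f (m \<cdot>\<^sub>M s) \<cdot>\<^sub>N r = (f (m \<cdot>\<^sub>M r) - f m \<cdot>\<^sub>N r) \<cdot>\<^sub>N (s\<^sup>2) \<and>
      f (brkM m n x \<cdot>\<^sub>M r) = f (brkM m n x) \<cdot>\<^sub>N r)"
proof -
  interpret bhp_map act T H P smulM brkM smulN brkN f
    using assms by (simp add: bhp_map_def)
  show ?thesis (is "?L \<longleftrightarrow> ?R")
  \<comment> \<open>Each side contains (a), (b) and (c), so both fail if one of these fails.\<close>
  proof (cases "bhp_map_central act T H P smulM brkM smulN brkN f")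
    case True
    then interpret bhp_map_central act T H P smulM brkM smulN brkN f .
    have smul_defect: "sd r (m \<cdot>\<^sub>M s) = sd r m \<cdot>\<^sub>N s\<^sup>2 \<longleftrightarrow>
        f (m \<cdot>\<^sub>M (s * r)) - f (m \<cdot>\<^sub>M s) \<cdot>\<^sub>N r = (f (m \<cdot>\<^sub>M r) - f m \<cdot>\<^sub>N r) \<cdot>\<^sub>N (s\<^sup>2)" for r s m
      by (simp add: smul_defect_def M.smul_smul)
    show ?thesis
    \<comment> \<open>Comparing bracket defects with (h) requires (f), which both sides imply: on
      the left it comes from bilinearity of the cross effect.\<close>
    proof (cases "\<forall>m m' n x. f (brkM m m' x + n) = f (brkM m m' x) + f n")
      case True
      then have "bhp_bilinear smulM brkM smulN brkN (bd x) \<longleftrightarrow>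
          (\<forall>m n r. f (brkM m n x \<cdot>\<^sub>M r) = f (brkM m n x) \<cdot>\<^sub>N r)" for x
        by (intro brk_defect_bilinear_iff) blast
      then show ?thesis
        unfolding bhp_quadratic_iff cross_bilinear_iff smul_defect
        using True brk_f_add brk_f_smul brk_f_brk by simp blast
    next
      case False
      then show ?thesis
        unfolding bhp_quadratic_iff cross_bilinear_iff by blast
    qed
  next
    case False
    have "\<not> ?L"
      using False bhp_map_axioms
      unfolding bhp_quadratic_iff bhp_map_central_def bhp_map_central_axioms_def by blast
    moreover have "\<not> ?R"
      using False bhp_map_axioms
      unfolding bhp_map_central_def bhp_map_central_axioms_def by blast
    ultimately show ?thesis
      by blast
  qed
qed

end
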